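(* Let $m,l,k$ be positive integers and let $\tilde\lambda=\{\lambda_n\}_{n=1}^{l}\subset(0,\infty)$. Then the following hold. (1) If $l\le k+m-2$ and $\{\lambda_n\}_{n=l+1}^{k+m-2}\subset(0,\infty)$ is an arbitrary sequence, then there exists a strict $k$-quasi-$m$-isometric completion of $\tilde\lambda$ whose initial weights are $\lambda_1,\dots,\lambda_{k+m-2}$ (an empty sequence being chosen if $l=k+m-2$). (2) If $l>k+m-2$, then there exists a $k$-quasi-$m$-isometric completion with initial weights $\tilde\lambda=\{\lambda_n\}_{n=1}^{l}$ if and only if both of the following hold: (a) $\displaystyle\sum_{j=0}^{m}(-1)^j\binom{m}{j}(\beta\tilde\lambda)_{k+n+j}=0$ for every integer $n$ with $0\le n\le l-(k+m)$ (no condition if $l<k+m$); (b) the unique real polynomial $w$ of degree at most $m-1$ satisfying $w(n)=(\beta\tilde\lambda)_{k+n}$ for $n=0,1,\dots,m-1$ also satisfies $w(n)>0$ for all integers $n\ge m$. Furthermore, in case (2) this completion is strict $k$-quasi-$m$-isometric if and only if the degree of $w$ is exactly $m-1$.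
   Context: For a bounded linear operator $T$ on a complex Hilbert space and a nonnegative integer $m$, put $\mathcal{B}_m(T)=\sum_{j=0}^{m}(-1)^j\binom{m}{j}T^{*(m-j)}T^{m-j}$. The operator $T$ is $k$-quasi-$m$-isometric if $T^{*k}\mathcal{B}_m(T)T^k=0$. It is strict $k$-quasi-$m$-isometric if it is $k$-quasi-$m$-isometric but not $k$-quasi-$(m-1)$-isometric. The unilateral weighted shift with weights $\{\lambda_n\}_{n\ge1}\subset(0,\infty)$ is the operator $S_\lambda$ on $\ell^2(\{0,1,2,\dots\})$ with orthonormal basis $\{e_n\}_{n\ge0}$ given by $S_\lambda e_n=\lambda_{n+1}e_{n+1}$. A (strict) $k$-quasi-$m$-isometric completion of a finite positive sequence $\{\lambda_n\}_{n=1}^{N}$ (also: a completion with initial weights $\{\lambda_n\}_{n=1}^N$) is an infinite positive sequence $\{\lambda_n\}_{n=1}^\infty$ extending it such that the unilateral weighted shift with weights $\{\lambda_n\}_{n=1}^\infty$ is bounded and (strict) $k$-quasi-$m$-isometric. For $\tilde\lambda=\{\lambda_n\}_{n=1}^{l}$, the numbers $(\beta\tilde\lambda)_s$, $0\le s\le l$, are defined by $(\beta\tilde\lambda)_0=1$ and $(\beta\tilde\lambda)_s=\prod_{i=1}^{s}\lambda_i^2$ for $s\ge1$. *)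

theory Defs
  imports "HOL-Analysis.Analysis" "HOL-Computational_Algebra.Polynomial"
begin

section \<open>Complex Hilbert spaces\<close>

text \<open>The inner product is linear in its first argument. The norm axiom makes it positive definite
  and ties it to the given (complete) norm.\<close>

class complex_hilbert = banach +
  fixes scaleC :: "complex \<Rightarrow> 'a \<Rightarrow> 'a"
    and cinner :: "'a \<Rightarrow> 'a \<Rightarrow> complex"
  assumes scaleC_of_real: "scaleC (complex_of_real r) x = r *\<^sub>R x"
    and scaleC_add_right: "scaleC a (x + y) = scaleC a x + scaleC a y"
    and scaleC_add_left: "scaleC (a + b) x = scaleC a x + scaleC b x"
    and scaleC_scaleC: "scaleC a (scaleC b x) = scaleC (a * b) x"
    and cinner_commute: "cinner x y = cnj (cinner y x)"
    and cinner_add_left: "cinner (x + y) z = cinner x z + cinner y z"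
    and cinner_scaleC_left: "cinner (scaleC a x) y = a * cinner x y"
    and cinner_self: "cinner x x = complex_of_real ((norm x)\<^sup>2)"

definition bounded_clinear :: "('a::complex_hilbert \<Rightarrow> 'a) \<Rightarrow> bool" where
  "bounded_clinear T \<longleftrightarrow> bounded_linear T \<and> (\<forall>a x. T (scaleC a x) = scaleC a (T x))"

text \<open>For a bounded operator the adjoint exists by the Riesz representation theorem;
  uniqueness is lemma \<open>cadjoint_eqI\<close> below.\<close>

definition cadjoint :: "('a::complex_hilbert \<Rightarrow> 'a) \<Rightarrow> 'a \<Rightarrow> 'a" where
  "cadjoint T = (THE S. \<forall>x y. cinner (T x) y = cinner x (S y))"

lemma cinner_minus_right: "cinner x (y - z) = cinner x y - cinner x (z::'a::complex_hilbert)"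
proof -
  have "cinner (y - z + z) x = cinner (y - z) x + cinner z x"
    by (rule cinner_add_left)
  then have "cinner (y - z) x = cinner y x - cinner z x"
    by simp
  then show ?thesis
    by (metis cinner_commute complex_cnj_diff)
qed

lemma cadjoint_eqI:
  fixes T :: "'a::complex_hilbert \<Rightarrow> 'a"
  assumes "\<And>x y. cinner (T x) y = cinner x (S y)"
  shows "cadjoint T = S"
  unfolding cadjoint_def
proof (rule the_equality)
  show "\<forall>x y. cinner (T x) y = cinner x (S y)"
    using assms by blast
next
  fix S' assume S': "\<forall>x y. cinner (T x) y = cinner x (S' y)"
  show "S' = S"
  proof
    fix y
    have "cinner (S' y - S y) (S' y - S y) = 0"
      using S' assms by (metis cinner_minus_right right_minus_eq)
    then show "S' y = S y"
      by (simp add: cinner_self)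
  qed
qed

section \<open>Quasi-isometric operators\<close>

definition Bop :: "nat \<Rightarrow> ('a::complex_hilbert \<Rightarrow> 'a) \<Rightarrow> 'a \<Rightarrow> 'a" where
  "Bop m T x = (\<Sum>j\<le>m. scaleC ((-1) ^ j * of_nat (m choose j))
                          ((cadjoint T ^^ (m - j)) ((T ^^ (m - j)) x)))"

definition quasi_isometric :: "nat \<Rightarrow> nat \<Rightarrow> ('a::complex_hilbert \<Rightarrow> 'a) \<Rightarrow> bool" where
  "quasi_isometric k m T \<longleftrightarrow> (\<forall>x. (cadjoint T ^^ k) (Bop m T ((T ^^ k) x)) = 0)"

text \<open>Only meant for \<open>m \<ge> 1\<close>. Since \<open>Bop 0 T\<close> is the identity, strictness for \<open>m = 1\<close> means
  that \<open>T\<^sup>*\<^sup>kT\<^sup>k \<noteq> 0\<close>.\<close>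

definition strict_quasi_isometric :: "nat \<Rightarrow> nat \<Rightarrow> ('a::complex_hilbert \<Rightarrow> 'a) \<Rightarrow> bool" where
  "strict_quasi_isometric k m T \<longleftrightarrow> quasi_isometric k m T \<and> \<not> quasi_isometric k (m - 1) T"

section \<open>The space of square-summable sequences\<close>

typedef ell2 = "{x :: nat \<Rightarrow> complex. summable (\<lambda>n. (cmod (x n))\<^sup>2)}"
  morphisms coord Abs_ell2
  by (rule exI[of _ "\<lambda>_. 0"]) simp

lemma summable_coord: "summable (\<lambda>n. (cmod (coord x n))\<^sup>2)"
  using coord[of x] by simp

lemma coord_Abs_ell2: "summable (\<lambda>n. (cmod (x n))\<^sup>2) \<Longrightarrow> coord (Abs_ell2 x) = x"
  by (rule Abs_ell2_inverse) simp

lemma ell2_eqI: "(\<And>n. coord x n = coord y n) \<Longrightarrow> x = y"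
  by (metis coord_inject ext)

lemma summable_sq_add:
  fixes f g :: "nat \<Rightarrow> complex"
  assumes "summable (\<lambda>n. (cmod (f n))\<^sup>2)" "summable (\<lambda>n. (cmod (g n))\<^sup>2)"
  shows "summable (\<lambda>n. (cmod (f n + g n))\<^sup>2)"
proof (rule summable_comparison_test')
  show "summable (\<lambda>n. 2 * (cmod (f n))\<^sup>2 + 2 * (cmod (g n))\<^sup>2)"
    by (intro summable_add summable_mult assms)
  fix n
  have "(cmod (f n + g n))\<^sup>2 \<le> (cmod (f n) + cmod (g n))\<^sup>2"
    by (simp add: norm_triangle_ineq power_mono)
  also have "\<dots> \<le> 2 * (cmod (f n))\<^sup>2 + 2 * (cmod (g n))\<^sup>2"
    using sum_squares_bound[of "cmod (f n)" "cmod (g n)"] by (simp add: power2_sum)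
  finally show "norm ((cmod (f n + g n))\<^sup>2) \<le> 2 * (cmod (f n))\<^sup>2 + 2 * (cmod (g n))\<^sup>2"
    by simp
qed

lemma summable_sq_mult:
  fixes f :: "nat \<Rightarrow> complex"
  assumes "summable (\<lambda>n. (cmod (f n))\<^sup>2)"
  shows "summable (\<lambda>n. (cmod (c * f n))\<^sup>2)"
  using assms by (simp add: norm_mult power_mult_distrib)

lemma summable_coord_mult: "summable (\<lambda>n. coord x n * cnj (coord y n))"
proof (rule summable_comparison_test')
  show "summable (\<lambda>n. (cmod (coord x n))\<^sup>2 + (cmod (coord y n))\<^sup>2)"
    by (intro summable_add summable_coord)
  fix n
  have "cmod (coord x n) * cmod (coord y n) \<le> 2 * cmod (coord x n) * cmod (coord y n)"
    by simp
  also have "\<dots> \<le> (cmod (coord x n))\<^sup>2 + (cmod (coord y n))\<^sup>2"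
    by (rule sum_squares_bound)
  finally show "norm (coord x n * cnj (coord y n)) \<le> (cmod (coord x n))\<^sup>2 + (cmod (coord y n))\<^sup>2"
    by (simp add: norm_mult)
qed

instantiation ell2 :: real_normed_vector
begin

definition "0 = Abs_ell2 (\<lambda>_. 0)"
definition "x + y = Abs_ell2 (\<lambda>n. coord x n + coord y n)"
definition "- x = Abs_ell2 (\<lambda>n. - coord x n)"
definition "x - y = Abs_ell2 (\<lambda>n. coord x n - coord y n)"
definition "scaleR r x = Abs_ell2 (\<lambda>n. complex_of_real r * coord x n)"
definition "norm x = sqrt (\<Sum>n. (cmod (coord x n))\<^sup>2)"
definition "sgn (x::ell2) = scaleR (inverse (norm x)) x"
definition "dist (x::ell2) y = norm (x - y)"
definition "uniformity = (INF e\<in>{0<..}. principal {(x, y::ell2). dist x y < e})"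
definition "open (U::ell2 set) \<longleftrightarrow> (\<forall>x\<in>U. \<forall>\<^sub>F (x', y) in uniformity. x' = x \<longrightarrow> y \<in> U)"

lemma coord_zero [simp]: "coord 0 n = 0"
  by (simp add: zero_ell2_def coord_Abs_ell2)

lemma coord_add [simp]: "coord (x + y) n = coord x n + coord y n"
  by (simp add: plus_ell2_def coord_Abs_ell2 summable_sq_add summable_coord)

lemma coord_uminus [simp]: "coord (- x) n = - coord x n"
  by (simp add: uminus_ell2_def coord_Abs_ell2 summable_coord)

lemma coord_minus [simp]: "coord (x - y) n = coord x n - coord y n"
  using summable_sq_add[OF summable_coord[of x] summable_coord[of "- y"]]
  by (simp add: minus_ell2_def coord_Abs_ell2)

lemma coord_scaleR [simp]: "coord (r *\<^sub>R x) n = complex_of_real r * coord x n"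
  by (simp add: scaleR_ell2_def coord_Abs_ell2 summable_sq_mult summable_coord)

lemma norm_ell2_sq: "(norm (x::ell2))\<^sup>2 = (\<Sum>n. (cmod (coord x n))\<^sup>2)"
  by (simp add: norm_ell2_def suminf_nonneg summable_coord)

lemma L2_set_le_norm_ell2: "L2_set (\<lambda>n. cmod (coord x n)) {..<K} \<le> norm x"
  unfolding L2_set_def norm_ell2_def
  by (intro real_sqrt_le_mono sum_le_suminf summable_coord) auto

lemma norm_ell2_leI:
  assumes "\<And>K. L2_set (\<lambda>n. cmod (coord x n)) {..<K} \<le> B"
  shows "norm x \<le> B"
proof -
  have B: "0 \<le> B"
    using assms[of 0] by simp
  have "(\<Sum>n. (cmod (coord x n))\<^sup>2) \<le> B\<^sup>2"
  proof (rule suminf_le_const[OF summable_coord])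
    fix K
    show "(\<Sum>n<K. (cmod (coord x n))\<^sup>2) \<le> B\<^sup>2"
      using assms[of K] B unfolding L2_set_def by (simp add: real_sqrt_le_iff' sqrt_le_D)
  qed
  then show ?thesis
    unfolding norm_ell2_def using B by (simp add: real_le_lsqrt)
qed

lemma cmod_coord_le_norm: "cmod (coord x n) \<le> norm x"
  using member_le_L2_set[of "{..<Suc n}" n "\<lambda>n. cmod (coord x n)"]
    L2_set_le_norm_ell2[of x "Suc n"] by simp

instance
proof
  fix x y z :: ell2 and r s :: real and U :: "ell2 set"
  show "x + y + z = x + (y + z)" "x + y = y + x" "0 + x = x" "- x + x = 0" "x - y = x + - y"
    by (rule ell2_eqI; simp)+
  show "r *\<^sub>R (x + y) = r *\<^sub>R x + r *\<^sub>R y" "(r + s) *\<^sub>R x = r *\<^sub>R x + s *\<^sub>R x"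
    "r *\<^sub>R s *\<^sub>R x = (r * s) *\<^sub>R x" "1 *\<^sub>R x = x"
    by (rule ell2_eqI; simp add: algebra_simps)+
  show "dist x y = norm (x - y)" "sgn x = scaleR (inverse (norm x)) x"
    "uniformity = (INF e\<in>{0<..}. principal {(x, y::ell2). dist x y < e})"
    "open U \<longleftrightarrow> (\<forall>x\<in>U. \<forall>\<^sub>F (x', y) in uniformity. x' = x \<longrightarrow> y \<in> U)"
    by (fact dist_ell2_def sgn_ell2_def uniformity_ell2_def open_ell2_def)+
  show "norm x = 0 \<longleftrightarrow> x = 0"
  proof
    assume "norm x = 0"
    then have "coord x n = 0" for n
      using cmod_coord_le_norm[of x n] by simp
    then show "x = 0"
      by (intro ell2_eqI) simp
  qed (simp add: norm_ell2_def)
  show "norm (x + y) \<le> norm x + norm y"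
  proof (rule norm_ell2_leI)
    fix K
    have "L2_set (\<lambda>n. cmod (coord (x + y) n)) {..<K}
        \<le> L2_set (\<lambda>n. cmod (coord x n) + cmod (coord y n)) {..<K}"
      by (rule L2_set_mono) (simp_all add: norm_triangle_ineq)
    also have "\<dots> \<le> L2_set (\<lambda>n. cmod (coord x n)) {..<K} + L2_set (\<lambda>n. cmod (coord y n)) {..<K}"
      by (rule L2_set_triangle_ineq)
    also have "\<dots> \<le> norm x + norm y"
      by (intro add_mono L2_set_le_norm_ell2)
    finally show "L2_set (\<lambda>n. cmod (coord (x + y) n)) {..<K} \<le> norm x + norm y" .
  qed
  show "norm (r *\<^sub>R x) = \<bar>r\<bar> * norm x"
  proof -
    have "(\<Sum>n. (cmod (coord (r *\<^sub>R x) n))\<^sup>2) = r\<^sup>2 * (\<Sum>n. (cmod (coord x n))\<^sup>2)"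
      by (simp add: norm_mult power_mult_distrib suminf_mult summable_coord)
    then show ?thesis
      by (simp add: norm_ell2_def real_sqrt_mult)
  qed
qed

end

instance ell2 :: banach
proof
  fix X :: "nat \<Rightarrow> ell2"
  assume X: "Cauchy X"
  have CX: "\<exists>N. \<forall>i\<ge>N. \<forall>j\<ge>N. norm (X i - X j) < e" if "e > 0" for e
    using X that unfolding Cauchy_def dist_norm by blast
  have "Cauchy (\<lambda>i. coord (X i) n)" for n
  proof (rule metric_CauchyI)
    fix e :: real assume "e > 0"
    then obtain N where "\<forall>i\<ge>N. \<forall>j\<ge>N. norm (X i - X j) < e"
      using CX by blast
    then have "\<forall>i\<ge>N. \<forall>j\<ge>N. dist (coord (X i) n) (coord (X j) n) < e"
      unfolding dist_norm by (metis cmod_coord_le_norm coord_minus le_less_trans)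
    then show "\<exists>N. \<forall>i\<ge>N. \<forall>j\<ge>N. dist (coord (X i) n) (coord (X j) n) < e"
      by blast
  qed
  then have "\<forall>n. \<exists>L. (\<lambda>i. coord (X i) n) \<longlonglongrightarrow> L"
    using Cauchy_convergent_iff convergent_def by blast
  then obtain L where L: "\<And>n. (\<lambda>i. coord (X i) n) \<longlonglongrightarrow> L n"
    by metis
  have bound: "L2_set (\<lambda>n. cmod (coord (X i) n - L n)) {..<K} \<le> e"
    if N: "\<forall>i\<ge>N. \<forall>j\<ge>N. norm (X i - X j) < e" and i: "i \<ge> N" for N i K e
  proof (rule LIMSEQ_le_const2)
    show "(\<lambda>j. L2_set (\<lambda>n. cmod (coord (X i) n - coord (X j) n)) {..<K})
        \<longlonglongrightarrow> L2_set (\<lambda>n. cmod (coord (X i) n - L n)) {..<K}"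
      unfolding L2_set_def by (intro tendsto_intros L)
    have "L2_set (\<lambda>n. cmod (coord (X i) n - coord (X j) n)) {..<K} \<le> e" if "j \<ge> N" for j
      using L2_set_le_norm_ell2[of "X i - X j" K] N i that by (simp add: order_trans less_imp_le)
    then show "\<exists>N. \<forall>j\<ge>N. L2_set (\<lambda>n. cmod (coord (X i) n - coord (X j) n)) {..<K} \<le> e"
      by blast
  qed
  have "summable (\<lambda>n. (cmod (L n))\<^sup>2)"
  proof -
    obtain N where N: "\<forall>i\<ge>N. \<forall>j\<ge>N. norm (X i - X j) < 1"
      using CX[of 1] by auto
    have "summable (\<lambda>n. (cmod (L n - coord (X N) n))\<^sup>2)"
    proof (rule bounded_imp_summable)
      fix K
      show "(\<Sum>n\<le>K. (cmod (L n - coord (X N) n))\<^sup>2) \<le> 1"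
        using bound[OF N, of N "Suc K"]
        by (simp add: L2_set_def norm_minus_commute lessThan_Suc_atMost)
    qed simp
    from summable_sq_add[OF this summable_coord[of "X N"]] show ?thesis
      by simp
  qed
  then have coordL: "coord (Abs_ell2 L) = L"
    by (rule coord_Abs_ell2)
  have "\<exists>N. \<forall>i\<ge>N. norm (X i - Abs_ell2 L) < e" if "e > 0" for e
  proof -
    obtain N where N: "\<forall>i\<ge>N. \<forall>j\<ge>N. norm (X i - X j) < e / 2"
      using CX[of "e / 2"] \<open>e > 0\<close> by auto
    have "norm (X i - Abs_ell2 L) \<le> e / 2" if "i \<ge> N" for i
      by (rule norm_ell2_leI) (use bound[OF N that] in \<open>simp add: coordL\<close>)
    then have "\<forall>i\<ge>N. norm (X i - Abs_ell2 L) < e"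
      using \<open>e > 0\<close> by (fastforce intro: le_less_trans)
    then show ?thesis
      by blast
  qed
  then have "X \<longlonglongrightarrow> Abs_ell2 L"
    by (rule LIMSEQ_I)
  then show "convergent X"
    unfolding convergent_def by blast
qed

instantiation ell2 :: complex_hilbert
begin

definition "scaleC a x = Abs_ell2 (\<lambda>n. a * coord x n)"
definition "cinner x y = (\<Sum>n. coord x n * cnj (coord y n))"

lemma coord_scaleC [simp]: "coord (scaleC a x) n = a * coord x n"
  by (simp add: scaleC_ell2_def coord_Abs_ell2 summable_sq_mult summable_coord)

instance
proof
  fix x y z :: ell2 and r :: real and a b :: complex
  show "scaleC (complex_of_real r) x = r *\<^sub>R x"
    "scaleC a (x + y) = scaleC a x + scaleC a y" "scaleC (a + b) x = scaleC a x + scaleC b x"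
    "scaleC a (scaleC b x) = scaleC (a * b) x"
    by (rule ell2_eqI; simp add: algebra_simps)+
  show "cinner x y = cnj (cinner y x)"
    unfolding cinner_ell2_def
    using bounded_linear.suminf[OF bounded_linear_cnj summable_coord_mult[of y x]]
    by (simp add: mult.commute)
  show "cinner (x + y) z = cinner x z + cinner y z"
    by (simp add: cinner_ell2_def distrib_right suminf_add summable_coord_mult)
  show "cinner (scaleC a x) y = a * cinner x y"
    by (simp add: cinner_ell2_def mult.assoc suminf_mult summable_coord_mult)
  show "cinner x x = complex_of_real ((norm x)\<^sup>2)"
    unfolding cinner_ell2_def norm_ell2_sq
    using suminf_of_real[OF summable_coord[of x], where 'a=complex]
    by (simp add: complex_norm_square[symmetric] mult.commute)
qed

end

definition ebasis :: "nat \<Rightarrow> ell2" where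
  "ebasis n = Abs_ell2 (\<lambda>i. if i = n then 1 else 0)"

lemma coord_ebasis: "coord (ebasis n) i = (if i = n then 1 else 0)"
proof -
  have "summable (\<lambda>i. (cmod (if i = n then 1 else 0))\<^sup>2)"
    by (rule summable_finite[of "{n}"]) auto
  then show ?thesis
    by (simp add: ebasis_def coord_Abs_ell2)
qed

section \<open>Weighted shifts and completions\<close>

text \<open>Weights are functions on \<open>nat\<close> whose value at \<open>0\<close> is ignored. A bounded operator is
  determined by its values on the basis, so for given weights there is at most one such \<open>T\<close>, and
  there is one exactly if the weighted shift is bounded.\<close>

definition is_bounded_weighted_shift :: "(nat \<Rightarrow> real) \<Rightarrow> (ell2 \<Rightarrow> ell2) \<Rightarrow> bool" where
  "is_bounded_weighted_shift lam T \<longleftrightarrow>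
     bounded_clinear T \<and>
     (\<forall>n. T (ebasis n) = scaleC (complex_of_real (lam (n + 1))) (ebasis (n + 1)))"

text \<open>Here \<open>mu\<close> is the completion and only \<open>lam 1, \<dots>, lam l\<close> matter.\<close>

definition extends_weights :: "(nat \<Rightarrow> real) \<Rightarrow> nat \<Rightarrow> (nat \<Rightarrow> real) \<Rightarrow> bool" where
  "extends_weights lam l mu \<longleftrightarrow> (\<forall>n\<ge>1. 0 < mu n) \<and> (\<forall>n\<in>{1..l}. mu n = lam n)"

definition quasi_completion :: "nat \<Rightarrow> nat \<Rightarrow> (nat \<Rightarrow> real) \<Rightarrow> nat \<Rightarrow> (nat \<Rightarrow> real) \<Rightarrow> bool" where
  "quasi_completion k m lam l mu \<longleftrightarrow>
     extends_weights lam l mu \<and> (\<exists>T. is_bounded_weighted_shift mu T \<and> quasi_isometric k m T)"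

definition strict_quasi_completion ::
    "nat \<Rightarrow> nat \<Rightarrow> (nat \<Rightarrow> real) \<Rightarrow> nat \<Rightarrow> (nat \<Rightarrow> real) \<Rightarrow> bool" where
  "strict_quasi_completion k m lam l mu \<longleftrightarrow>
     extends_weights lam l mu \<and> (\<exists>T. is_bounded_weighted_shift mu T \<and> strict_quasi_isometric k m T)"

definition weight_beta :: "(nat \<Rightarrow> real) \<Rightarrow> nat \<Rightarrow> real" where
  "weight_beta lam s = (\<Prod>i\<in>{1..s}. (lam i)\<^sup>2)"

section \<open>The interpolating polynomial\<close>

text \<open>Well-defined for \<open>m \<ge> 1\<close>, by lemma \<open>interp_poly_ex1\<close> below.\<close>

definition interp_poly :: "nat \<Rightarrow> nat \<Rightarrow> (nat \<Rightarrow> real) \<Rightarrow> real poly" where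
  "interp_poly k m lam =
     (THE w. degree w \<le> m - 1 \<and> (\<forall>n<m. poly w (real n) = weight_beta lam (k + n)))"

lemma interp_exists:
  fixes f :: "nat \<Rightarrow> real"
  shows "\<exists>w. degree w \<le> m \<and> (\<forall>n<Suc m. poly w (real n) = f n)"
proof (induction m)
  case 0
  show ?case
    by (rule exI[of _ "[:f 0:]"]) simp
next
  case (Suc m)
  then obtain w where w: "degree w \<le> m" "\<And>n. n < Suc m \<Longrightarrow> poly w (real n) = f n"
    by blast
  define p :: "real poly" where "p = (\<Prod>i<Suc m. [:- real i, 1:])"
  have p0: "poly p (real n) = 0 \<longleftrightarrow> n < Suc m" for n
    by (auto simp: p_def poly_prod)
  have dp: "degree p = Suc m"
    unfolding p_def by (subst degree_prod_eq_sum_degree) auto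
  define v where "v = w + smult ((f (Suc m) - poly w (real (Suc m))) / poly p (real (Suc m))) p"
  have "degree v \<le> Suc m"
    unfolding v_def using w(1) dp by (intro degree_add_le) auto
  moreover have "poly v (real n) = f n" if "n < Suc (Suc m)" for n
    using that w(2)[of n] p0[of n] p0[of "Suc m"] unfolding v_def
    by (cases "n = Suc m") (auto simp del: of_nat_Suc)
  ultimately show ?case
    by blast
qed

lemma interp_poly_ex1:
  assumes "m \<ge> 1"
  shows "\<exists>!w. degree w \<le> m - 1 \<and> (\<forall>n<m. poly w (real n) = weight_beta lam (k + n))"
proof -
  have "v = w"
    if "degree v \<le> m - 1" "\<forall>n<m. poly v (real n) = weight_beta lam (k + n)"
      "degree w \<le> m - 1" "\<forall>n<m. poly w (real n) = weight_beta lam (k + n)" for v w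
  proof (rule poly_eqI_degree[of "real ` {..<m}"])
    show "card (real ` {..<m}) > degree v" "card (real ` {..<m}) > degree w"
      using that assms by (auto simp: card_image)
  qed (use that in auto)
  then show ?thesis
    using interp_exists[of "m - 1" "\<lambda>n. weight_beta lam (k + n)"] assms by (auto intro!: ex_ex1I)
qed

end

theory Submission
  imports Defs
begin

text \<open>
  Write \<open>\<beta> = weight_beta \<mu>\<close> for the moments of a positive weight sequence \<open>\<mu>\<close> and \<open>T\<close> for its shift.
  The operator \<open>T\<^sup>*\<^sup>j T\<^sup>j\<close> is diagonal with entries \<open>\<beta> (n + j) / \<beta> n\<close>, so \<open>T\<^sup>*\<^sup>k B\<^sub>m(T) T\<^sup>k\<close> is diagonal
  too, and up to sign its \<open>n\<close>-th entry is the \<open>m\<close>-th finite difference of \<open>i \<mapsto> \<beta> (k + i)\<close> at \<open>n\<close>,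
  divided by \<open>\<beta> n\<close> (\<open>quasi_isometric_shift_iff\<close>). Hence \<open>T\<close> is \<open>k\<close>-quasi-\<open>m\<close>-isometric exactly if
  \<open>i \<mapsto> \<beta> (k + i)\<close> is a polynomial \<open>w\<close> of degree less than \<open>m\<close> (\<open>fin_diff_eq_0_iff\<close>), and then it is strict
  exactly if the coefficient of \<open>w\<close> at \<open>m - 1\<close> does not vanish (\<open>strict_quasi_isometric_shift_iff\<close>).

  Conversely, every positive sequence \<open>b\<close> with \<open>b 0 = 1\<close> for which \<open>i \<mapsto> b (k + i)\<close> is a polynomial
  consists of the moments of a bounded shift (\<open>completion_of_moments\<close>): its squared weights are the quotients
  \<open>b n / b (n - 1)\<close>, and \<open>w (n + 1) / w n\<close> converges to \<open>1\<close>.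

  If \<open>l > k + m - 2\<close>, the given weights fix \<open>w\<close> by its values at \<open>0, \<dots>, m - 1\<close>; the remaining
  prescribed moments agree with \<open>w\<close> exactly if their \<open>m\<close>-th differences vanish
  (\<open>fin_diff_determines\<close>), and positivity of \<open>w\<close> on the naturals is what is left to ask. If all of
  \<open>\<lambda>\<^sub>1, \<dots>, \<lambda>\<^bsub>k+m-2\<^esub>\<close> are prescribed and nothing else, then only the \<open>m - 1\<close> values \<open>w 0, \<dots>, w (m - 2)\<close>
  are fixed, and adding a large multiple of \<open>x (x - 1) \<cdots> (x - (m - 2))\<close> to their interpolant makes
  \<open>w\<close> positive and of degree exactly \<open>m - 1\<close> (\<open>positive_interpolation\<close>).
\<close>

section \<open>Finite differences\<close>

text \<open>The \<open>m\<close>-th finite difference of \<open>f\<close> at \<open>n\<close>, up to the sign \<open>(-1) ^ m\<close>: the operator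
  \<open>(I - E) ^ m\<close> for the translation \<open>E\<close> by \<open>1\<close>.\<close>

definition fin_diff :: "nat \<Rightarrow> (nat \<Rightarrow> real) \<Rightarrow> nat \<Rightarrow> real" where
  "fin_diff m f n = (\<Sum>j\<le>m. (-1) ^ j * real (m choose j) * f (n + j))"

lemma fin_diff_0: "fin_diff 0 f n = f n"
  by (simp add: fin_diff_def)

lemma fin_diff_Suc: "fin_diff (Suc m) f n = fin_diff m (\<lambda>i. f i - f (Suc i)) n"
proof -
  have "fin_diff m f n = (\<Sum>j\<le>Suc m. (-1) ^ j * real (m choose j) * f (n + j))"
    by (simp add: fin_diff_def binomial_eq_0)
  also have "\<dots> = f n + (\<Sum>j\<le>m. (-1) ^ Suc j * real (m choose Suc j) * f (n + Suc j))"
    by (subst sum.atMost_Suc_shift) simp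
  finally have *: "fin_diff m f n = \<dots>" .
  have "fin_diff (Suc m) f n
      = f n + (\<Sum>j\<le>m. (-1) ^ Suc j * real (Suc m choose Suc j) * f (n + Suc j))"
    unfolding fin_diff_def by (subst sum.atMost_Suc_shift) simp
  also have "\<dots> = fin_diff m f n - (\<Sum>j\<le>m. (-1) ^ j * real (m choose j) * f (Suc (n + j)))"
    unfolding * by (simp add: algebra_simps sum.distrib sum_subtractf sum_negf)
  also have "\<dots> = fin_diff m (\<lambda>i. f i - f (Suc i)) n"
    by (simp add: fin_diff_def algebra_simps sum_subtractf)
  finally show ?thesis .
qed

lemma fin_diff_minus: "fin_diff m (\<lambda>i. f i - g i) n = fin_diff m f n - fin_diff m g n"
  by (simp add: fin_diff_def algebra_simps sum_subtractf)

text \<open>The reversed sum is the one in which the entries of \<open>Bop\<close> appear.\<close>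

lemma fin_diff_reversed:
  "(\<Sum>j\<le>m. (-1) ^ j * real (m choose j) * f (n + (m - j))) = (-1) ^ m * fin_diff m f n"
proof -
  have "(\<Sum>j\<le>m. (-1) ^ j * real (m choose j) * f (n + (m - j)))
      = (\<Sum>j\<le>m. (-1) ^ (m - j) * real (m choose (m - j)) * f (n + (m - (m - j))))"
    using sum.nat_diff_reindex[of "\<lambda>j. (-1) ^ j * real (m choose j) * f (n + (m - j))" "Suc m"]
    by (simp add: lessThan_Suc_atMost)
  also have "\<dots> = (\<Sum>j\<le>m. (-1) ^ m * ((-1) ^ j * real (m choose j) * f (n + j)))"
  proof (rule sum.cong[OF refl])
    fix j assume "j \<in> {..m}"
    then have j: "j \<le> m"
      by simp
    then have "(-1 :: real) ^ (m - j) = (-1) ^ m * (-1) ^ j"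
      by (simp add: power_diff minus_one_power_iff)
    with j show "(-1) ^ (m - j) * real (m choose (m - j)) * f (n + (m - (m - j)))
        = (-1) ^ m * ((-1) ^ j * real (m choose j) * f (n + j))"
      by (simp add: binomial_symmetric[symmetric])
  qed
  finally show ?thesis
    by (simp add: fin_diff_def sum_distrib_left)
qed

text \<open>Since the coefficient of \<open>f (n + m)\<close> in the \<open>m\<close>-th difference is \<open>(-1) ^ m\<close>, vanishing
  differences form a linear recurrence. Only differences inside \<open>{0..L}\<close> are needed, so the lemma
  applies to finite sections of a sequence as well.\<close>

lemma fin_diff_determines:
  assumes diff: "\<And>n. n + m \<le> L \<Longrightarrow> fin_diff m f n = 0"
    and init: "\<And>n. n < m \<Longrightarrow> f n = 0"
  shows "n \<le> L \<Longrightarrow> f n = 0"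
proof (induction n rule: less_induct)
  case (less n)
  show ?case
  proof (cases "n < m")
    case False
    have "fin_diff m f (n - m) = (\<Sum>j\<in>{m}. (-1) ^ j * real (m choose j) * f (n - m + j))"
      unfolding fin_diff_def
    proof (rule sum.mono_neutral_right)
      show "\<forall>j\<in>{..m} - {m}. (-1) ^ j * real (m choose j) * f (n - m + j) = 0"
      proof
        fix j assume "j \<in> {..m} - {m}"
        then have "f (n - m + j) = 0"
          using less False by (intro less.IH) auto
        then show "(-1) ^ j * real (m choose j) * f (n - m + j) = 0"
          by simp
      qed
    qed auto
    also have "\<dots> = (-1) ^ m * f n"
      using False by simp
    finally show ?thesis
      using diff[of "n - m"] less.prems False by simp
  qed (rule init)
qed

text \<open>Throughout, \<open>\<forall>i\<ge>m. coeff w i = 0\<close> says that \<open>w\<close> has degree less than \<open>m\<close>, with the zero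
  polynomial as the only one for \<open>m = 0\<close>.\<close>

lemma coeff_translate_diff:
  fixes w :: "real poly"
  assumes "\<forall>i\<ge>Suc m. coeff w i = 0"
  shows "\<forall>i\<ge>m. coeff (w - pcompose w [:1, 1:]) i = 0"
proof (intro allI impI)
  fix i assume i: "m \<le> i"
  have dw: "degree w \<le> m"
    using assms by (intro degree_le) auto
  have dc: "degree (pcompose w [:1, 1:]) = degree w"
    by (simp add: degree_pcompose)
  show "coeff (w - pcompose w [:1, 1:]) i = 0"
  proof (cases "degree w = i")
    case True
    then show ?thesis
      using lead_coeff_comp[of "[:1, 1:]" w] dc by simp
  next
    case False
    then have "degree w < i"
      using i dw by simp
    then show ?thesis
      using dc by (simp add: coeff_eq_0)
  qed
qed

lemma fin_diff_poly_eq_0: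
  assumes "\<forall>i\<ge>m. coeff w i = 0"
  shows "fin_diff m (\<lambda>i. poly w (real i)) n = 0"
  using assms
proof (induction m arbitrary: w)
  case 0
  then have "w = 0"
    by (simp add: poly_eq_iff)
  then show ?case
    by (simp add: fin_diff_0)
next
  case (Suc m)
  have "(\<lambda>i. poly w (real i) - poly w (real (Suc i)))
      = (\<lambda>i. poly (w - pcompose w [:1, 1:]) (real i))"
    by (simp add: poly_pcompose)
  then show ?case
    using Suc.IH[OF coeff_translate_diff[OF Suc.prems]] by (simp add: fin_diff_Suc)
qed

lemma fin_diff_eq_0_iff:
  "(\<forall>n. fin_diff m f n = 0) \<longleftrightarrow> (\<exists>w. (\<forall>i\<ge>m. coeff w i = 0) \<and> (\<forall>n. f n = poly w (real n)))"
proof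
  assume *: "\<forall>n. fin_diff m f n = 0"
  obtain w where w: "\<forall>i\<ge>m. coeff w i = 0" "\<And>n. n < m \<Longrightarrow> f n = poly w (real n)"
  proof (cases m)
    case 0
    then show thesis
      by (intro that[of 0]) auto
  next
    case (Suc m')
    then obtain w where "degree w \<le> m'" "\<forall>n<m. poly w (real n) = f n"
      using interp_exists[of m' f] by auto
    then show thesis
      using Suc by (intro that[of w]) (auto simp: coeff_eq_0)
  qed
  have "f n - poly w (real n) = 0" for n
    by (rule fin_diff_determines[of m n "\<lambda>i. f i - poly w (real i)"])
      (use * w in \<open>simp_all add: fin_diff_minus fin_diff_poly_eq_0\<close>)
  then show "\<exists>w. (\<forall>i\<ge>m. coeff w i = 0) \<and> (\<forall>n. f n = poly w (real n))"
    using w(1) by auto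
next
  assume "\<exists>w. (\<forall>i\<ge>m. coeff w i = 0) \<and> (\<forall>n. f n = poly w (real n))"
  then obtain w where "\<forall>i\<ge>m. coeff w i = 0" "f = (\<lambda>n. poly w (real n))"
    by blast
  then show "\<forall>n. fin_diff m f n = 0"
    by (simp add: fin_diff_poly_eq_0)
qed

lemma poly_eq_on_nats:
  fixes v w :: "real poly"
  assumes "\<And>n::nat. poly v (real n) = poly w (real n)"
  shows "v = w"
proof -
  have "range real \<subseteq> {x. poly (v - w) x = 0}"
    using assms by auto
  moreover have "infinite (range real)"
    by (simp add: finite_image_iff inj_on_def)
  ultimately have "infinite {x. poly (v - w) x = 0}"
    by (rule infinite_super)
  then show ?thesis
    using poly_roots_finite[of "v - w"] by auto
qed

section \<open>Growth of polynomials\<close>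

lemma poly_quotient_tendsto_0:
  fixes v w :: "real poly"
  assumes "v = 0 \<or> degree v < degree w"
  shows "(\<lambda>n. poly v (real n) / poly w (real n)) \<longlonglongrightarrow> 0"
proof (cases "v = 0")
  case False
  have "filterlim (\<lambda>n. real n) at_infinity sequentially"
    by (rule filterlim_at_top_imp_at_infinity[OF filterlim_real_sequentially])
  then show ?thesis
    using filterlim_compose[OF poly_divide_tendsto_0_at_infinity] assms False by blast
qed simp

lemma poly_successive_quotients_bounded:
  fixes w :: "real poly"
  assumes pos: "\<And>n. poly w (real n) > 0"
  shows "\<exists>K. \<forall>n. poly w (real (Suc n)) / poly w (real n) \<le> K"
proof -
  define v where "v = w - pcompose w [:1, 1:]"
  have v0: "v = 0 \<or> degree v < degree w"
  proof (cases "v = 0")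
    case False
    have "\<forall>i\<ge>degree w. coeff v i = 0"
      unfolding v_def by (rule coeff_translate_diff) (simp add: coeff_eq_0)
    then have "\<not> degree w \<le> degree v"
      using False by auto
    then show ?thesis
      by simp
  qed simp
  have "Bseq (\<lambda>n. poly v (real n) / poly w (real n))"
    by (rule convergent_imp_Bseq[OF convergentI[OF poly_quotient_tendsto_0[OF v0]]])
  then obtain K where K: "\<And>n. \<bar>poly v (real n) / poly w (real n)\<bar> \<le> K"
    unfolding Bseq_def by auto
  have "poly w (real (Suc n)) / poly w (real n) \<le> 1 + K" for n
  proof -
    have "poly w (real (Suc n)) / poly w (real n) = 1 - poly v (real n) / poly w (real n)"
      using pos[of n] by (simp add: v_def poly_pcompose field_simps)
    then show ?thesis
      using K[of n] by linarith
  qed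
  then show ?thesis
    by blast
qed

lemma positive_interpolation:
  fixes f :: "nat \<Rightarrow> real"
  assumes f: "\<And>n. n < d \<Longrightarrow> f n > 0"
  shows "\<exists>w. degree w = d \<and> (\<forall>n<d. poly w (real n) = f n) \<and> (\<forall>n. poly w (real n) > 0)"
proof -
  define p :: "real poly" where "p = (\<Prod>i<d. [:- real i, 1:])"
  have dp: "degree p = d"
    unfolding p_def by (subst degree_prod_eq_sum_degree) auto
  have p_eq: "poly p (real n) = (\<Prod>i<d. real n - real i)" for n
    by (simp add: p_def poly_prod)
  have p0: "poly p (real n) = 0" if "n < d" for n
    using that by (auto simp: p_eq)
  have p_pos: "poly p (real n) > 0" if "n \<ge> d" for n
    unfolding p_eq by (rule prod_pos) (use that in auto)
  obtain v where v: "v = 0 \<or> degree v < d" "\<forall>n<d. poly v (real n) = f n"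
  proof (cases d)
    case 0
    then show thesis
      by (intro that[of 0]) auto
  next
    case (Suc d')
    then show thesis
      using interp_exists[of d' f] that by (metis less_Suc_eq_le)
  qed
  have "Bseq (\<lambda>n. poly v (real n) / poly p (real n))"
    using v(1) dp by (blast intro: convergent_imp_Bseq convergentI poly_quotient_tendsto_0)
  then obtain K where K: "K > 0" "\<And>n. \<bar>poly v (real n) / poly p (real n)\<bar> \<le> K"
    unfolding Bseq_def by auto
  \<comment> \<open>\<open>p\<close> is positive at every natural number from \<open>d\<close> on, and there \<open>v \<ge> - K p\<close>.\<close>
  define w where "w = v + smult (K + 1) p"
  have "degree w = d"
  proof (cases "v = 0")
    case True
    then show ?thesis
      using K(1) dp by (simp add: w_def)
  next
    case False
    then show ?thesis
      using K(1) dp v(1) unfolding w_def by (subst degree_add_eq_right) auto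
  qed
  moreover have w_f: "\<forall>n<d. poly w (real n) = f n"
    using v(2) p0 by (simp add: w_def)
  moreover have "poly w (real n) > 0" for n
  proof (cases "n < d")
    case True
    then show ?thesis
      using w_f f by simp
  next
    case False
    then have p: "poly p (real n) > 0"
      using p_pos by simp
    have "- K \<le> poly v (real n) / poly p (real n)"
      using K(2)[of n] by linarith
    then have "- K * poly p (real n) \<le> poly v (real n)"
      using p by (simp add: pos_le_divide_eq)
    then show ?thesis
      using p by (simp add: w_def algebra_simps)
  qed
  ultimately show ?thesis
    by blast
qed

section \<open>Bounded weighted shifts and their adjoints\<close>

lemma norm_ebasis: "norm (ebasis n) = 1"
proof -
  have "(\<Sum>i. (cmod (coord (ebasis n) i))\<^sup>2) = (\<Sum>i\<in>{n}. (cmod (coord (ebasis n) i))\<^sup>2)"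
    by (rule suminf_finite) (auto simp: coord_ebasis)
  then show ?thesis
    by (simp add: norm_ell2_def coord_ebasis)
qed

lemma bounded_linear_coord: "bounded_linear (\<lambda>x. coord x n)"
  by (rule bounded_linear_intro[where K = 1])
    (simp_all add: cmod_coord_le_norm scaleR_conv_of_real)

lemma coord_sum: "coord (sum f A) n = (\<Sum>i\<in>A. coord (f i) n)"
  using linear_sum[OF bounded_linear.linear[OF bounded_linear_coord]] .

lemma ebasis_expansion: "(\<lambda>N. \<Sum>i<N. scaleC (coord x i) (ebasis i)) \<longlonglongrightarrow> x"
proof (rule LIMSEQ_I)
  fix e :: real assume e: "0 < e"
  let ?t = "\<lambda>N. \<Sum>i<N. scaleC (coord x i) (ebasis i)"
  have coord_t: "coord (?t N) n = (if n < N then coord x n else 0)" for N n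
  proof -
    have "coord (?t N) n = (\<Sum>i<N. if n = i then coord x i else 0)"
      unfolding coord_sum by (rule sum.cong) (auto simp: coord_ebasis)
    then show ?thesis
      by simp
  qed
  have norm_t: "(norm (?t N - x))\<^sup>2 = (\<Sum>n. (cmod (coord x (n + N)))\<^sup>2)" for N
  proof -
    have "(norm (?t N - x))\<^sup>2 = (\<Sum>n. (cmod (coord (?t N - x) (n + N)))\<^sup>2)
        + (\<Sum>n<N. (cmod (coord (?t N - x) n))\<^sup>2)"
      unfolding norm_ell2_sq by (rule suminf_split_initial_segment[OF summable_coord])
    then show ?thesis
      by (simp add: coord_t)
  qed
  obtain N0 where N0: "\<And>N. N \<ge> N0 \<Longrightarrow> norm (\<Sum>n. (cmod (coord x (n + N)))\<^sup>2) < e\<^sup>2"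
    using suminf_exist_split[of "e\<^sup>2" "\<lambda>n. (cmod (coord x n))\<^sup>2"] e summable_coord by fastforce
  have "norm (?t N - x) < e" if "N \<ge> N0" for N
  proof -
    have "(norm (?t N - x))\<^sup>2 < e\<^sup>2"
      using N0[OF that] by (simp flip: norm_t)
    then show ?thesis
      using e by (simp add: power_less_imp_less_base)
  qed
  then show "\<exists>N0. \<forall>N\<ge>N0. norm (?t N - x) < e"
    by blast
qed

lemma bounded_weighted_shift_weights_bounded:
  assumes "is_bounded_weighted_shift mu T"
  shows "\<exists>K. \<forall>n\<ge>1. \<bar>mu n\<bar> \<le> K"
proof -
  have T: "bounded_linear T" "\<And>n. T (ebasis n) = scaleC (complex_of_real (mu (n + 1))) (ebasis (n + 1))"
    using assms by (auto simp: is_bounded_weighted_shift_def bounded_clinear_def)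
  obtain K where K: "\<And>x. norm (T x) \<le> norm x * K"
    using bounded_linear.bounded[OF T(1)] by blast
  have "\<bar>mu (n + 1)\<bar> \<le> K" for n
    using cmod_coord_le_norm[of "T (ebasis n)" "n + 1"] K[of "ebasis n"]
    by (simp add: T(2) coord_ebasis norm_ebasis)
  then have "\<forall>n\<ge>1. \<bar>mu n\<bar> \<le> K"
    by (metis le_add_diff_inverse2)
  then show ?thesis
    by blast
qed

text \<open>The definition of a bounded weighted shift gives its values on the basis only; by continuity
  they determine all coordinates of \<open>T x\<close>.\<close>

lemma coord_bounded_weighted_shift:
  assumes "is_bounded_weighted_shift mu T"
  shows "coord (T x) n = (if n = 0 then 0 else complex_of_real (mu n) * coord x (n - 1))"
proof -
  have T: "bounded_linear T" "\<And>a x. T (scaleC a x) = scaleC a (T x)"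
    "\<And>n. T (ebasis n) = scaleC (complex_of_real (mu (n + 1))) (ebasis (n + 1))"
    using assms by (auto simp: is_bounded_weighted_shift_def bounded_clinear_def)
  let ?t = "\<lambda>N. \<Sum>i<N. scaleC (coord x i) (ebasis i)"
  let ?r = "if n = 0 then 0 else complex_of_real (mu n) * coord x (n - 1)"
  have lim: "(\<lambda>N. coord (T (?t N)) n) \<longlonglongrightarrow> coord (T x) n"
    by (intro bounded_linear.tendsto[OF bounded_linear_coord] bounded_linear.tendsto[OF T(1)]
        ebasis_expansion)
  have coord_t: "coord (T (?t N)) n = ?r" if "N \<ge> n" for N
  proof -
    have "coord (T (?t N)) n
        = (\<Sum>i<N. coord x i * (complex_of_real (mu (i + 1)) * (if n = i + 1 then 1 else 0)))"
      by (simp add: linear_sum[OF bounded_linear.linear[OF T(1)]] T coord_sum coord_ebasis)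
    also have "\<dots> = (\<Sum>i<N. if i = n - 1 then ?r else 0)"
      by (rule sum.cong) auto
    also have "\<dots> = ?r"
      using that by auto
    finally show ?thesis .
  qed
  have "(\<lambda>N. coord (T (?t N)) n) \<longlonglongrightarrow> ?r"
    by (rule tendsto_eventually, rule eventually_sequentiallyI[of n], rule coord_t)
  then show ?thesis
    using LIMSEQ_unique[OF lim] by blast
qed

lemma summable_sq_weighted:
  fixes c :: "nat \<Rightarrow> real" and f :: "nat \<Rightarrow> complex"
  assumes "\<And>n. \<bar>c n\<bar> \<le> K" and "summable (\<lambda>n. (cmod (f n))\<^sup>2)"
  shows "summable (\<lambda>n. (cmod (complex_of_real (c n) * f n))\<^sup>2)"
proof (rule summable_comparison_test')
  show "summable (\<lambda>n. K\<^sup>2 * (cmod (f n))\<^sup>2)"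
    by (intro summable_mult assms)
  show "norm ((cmod (complex_of_real (c n) * f n))\<^sup>2) \<le> K\<^sup>2 * (cmod (f n))\<^sup>2" for n
    using power_mono[OF assms(1)[of n], of 2]
    by (simp add: norm_mult power_mult_distrib mult_right_mono)
qed

lemma bounded_weighted_shift_exists:
  assumes K: "\<And>n. n \<ge> 1 \<Longrightarrow> \<bar>mu n\<bar> \<le> K"
  shows "\<exists>T. is_bounded_weighted_shift mu T"
proof -
  define c where "c x n = (if n = 0 then 0 else complex_of_real (mu n) * coord x (n - 1))"
    for x and n :: nat
  have sum: "summable (\<lambda>n. (cmod (complex_of_real (mu (Suc n)) * coord x n))\<^sup>2)" for x
    by (rule summable_sq_weighted) (use K summable_coord in auto)
  have sum_c: "summable (\<lambda>n. (cmod (c x n))\<^sup>2)" for x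
    using sum[of x] by (subst summable_Suc_iff[symmetric]) (simp add: c_def)
  define T where "T x = Abs_ell2 (c x)" for x
  have coord_T: "coord (T x) n = c x n" for x n
    unfolding T_def by (simp add: coord_Abs_ell2 sum_c)
  have K0: "0 \<le> K"
    using K[of 1] by simp
  have "norm (T x) \<le> norm x * K" for x
  proof -
    have "(norm (T x))\<^sup>2 = (\<Sum>n. (cmod (c x (Suc n)))\<^sup>2)"
      using suminf_split_head[OF sum_c[of x]] by (simp add: norm_ell2_sq coord_T c_def)
    also have "\<dots> \<le> (\<Sum>n. K\<^sup>2 * (cmod (coord x n))\<^sup>2)"
    proof (rule suminf_le)
      show "(cmod (c x (Suc n)))\<^sup>2 \<le> K\<^sup>2 * (cmod (coord x n))\<^sup>2" for n
        using power_mono[OF K[of "Suc n"], of 2]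
        by (simp add: c_def norm_mult power_mult_distrib mult_right_mono)
      show "summable (\<lambda>n. (cmod (c x (Suc n)))\<^sup>2)"
        using sum_c by (subst summable_Suc_iff)
    qed (intro summable_mult summable_coord)
    also have "\<dots> = (norm x * K)\<^sup>2"
      by (simp add: suminf_mult summable_coord norm_ell2_sq power_mult_distrib)
    finally show ?thesis
      using K0 by (meson mult_nonneg_nonneg norm_ge_zero power2_le_imp_le)
  qed
  then have "bounded_linear T"
    by (intro bounded_linear_intro) (auto intro!: ell2_eqI simp: coord_T c_def algebra_simps)
  moreover have "T (scaleC a x) = scaleC a (T x)" for a x
    by (rule ell2_eqI) (simp add: coord_T c_def)
  moreover have "T (ebasis n) = scaleC (complex_of_real (mu (n + 1))) (ebasis (n + 1))" for n
    by (rule ell2_eqI) (auto simp: coord_T c_def coord_ebasis)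
  ultimately show ?thesis
    by (auto simp: is_bounded_weighted_shift_def bounded_clinear_def)
qed

lemma coord_cadjoint_shift:
  assumes T: "is_bounded_weighted_shift mu T"
  shows "coord (cadjoint T y) n = complex_of_real (mu (Suc n)) * coord y (Suc n)"
proof -
  obtain K where K: "\<forall>n\<ge>1. \<bar>mu n\<bar> \<le> K"
    using bounded_weighted_shift_weights_bounded[OF T] by blast
  define S where "S y = Abs_ell2 (\<lambda>n. complex_of_real (mu (Suc n)) * coord y (Suc n))" for y
  have coord_S: "coord (S y) n = complex_of_real (mu (Suc n)) * coord y (Suc n)" for y n
    unfolding S_def
  proof (subst coord_Abs_ell2)
    show "summable (\<lambda>n. (cmod (complex_of_real (mu (Suc n)) * coord y (Suc n)))\<^sup>2)"
    proof (rule summable_sq_weighted)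
      show "summable (\<lambda>n. (cmod (coord y (Suc n)))\<^sup>2)"
        using summable_coord[of y] by (subst summable_Suc_iff)
    qed (use K in auto)
  qed simp
  have "cadjoint T = S"
  proof (rule cadjoint_eqI)
    fix x y
    have "cinner (T x) y = (\<Sum>n. coord (T x) (Suc n) * cnj (coord y (Suc n)))"
      unfolding cinner_ell2_def
      using suminf_split_head[OF summable_coord_mult[of "T x" y]]
      by (simp add: coord_bounded_weighted_shift[OF T])
    also have "\<dots> = cinner x (S y)"
      by (simp add: cinner_ell2_def coord_S coord_bounded_weighted_shift[OF T] mult_ac)
    finally show "cinner (T x) y = cinner x (S y)" .
  qed
  then show ?thesis
    by (simp add: coord_S)
qed

section \<open>Quasi-isometric shifts in terms of moments\<close>

lemma weight_beta_0: "weight_beta mu 0 = 1"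
  by (simp add: weight_beta_def)

lemma weight_beta_Suc: "weight_beta mu (Suc n) = weight_beta mu n * (mu (Suc n))\<^sup>2"
  by (simp add: weight_beta_def mult.commute)

lemma weight_beta_pos:
  assumes "\<And>n. 1 \<le> n \<Longrightarrow> n \<le> s \<Longrightarrow> 0 < mu n"
  shows "0 < weight_beta mu s"
  unfolding weight_beta_def by (intro prod_pos zero_less_power) (use assms in auto)

lemma weight_beta_cong:
  assumes "\<And>n. 1 \<le> n \<Longrightarrow> n \<le> s \<Longrightarrow> mu n = nu n"
  shows "weight_beta mu s = weight_beta nu s"
  unfolding weight_beta_def using assms by (intro prod.cong) auto

context
  fixes mu :: "nat \<Rightarrow> real" and T :: "ell2 \<Rightarrow> ell2"
  assumes T: "is_bounded_weighted_shift mu T"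
    and pos: "\<And>n. n \<ge> 1 \<Longrightarrow> 0 < mu n"
begin

lemma coord_shift_power:
  "coord ((T ^^ j) x) (n + j) = complex_of_real (\<Prod>i<j. mu (n + Suc i)) * coord x n"
  by (induction j) (simp_all add: coord_bounded_weighted_shift[OF T] mult_ac)

lemma coord_cadjoint_shift_power:
  "coord ((cadjoint T ^^ j) y) n = complex_of_real (\<Prod>i<j. mu (n + Suc i)) * coord y (n + j)"
proof (induction j arbitrary: y)
  case (Suc j)
  have "coord ((cadjoint T ^^ Suc j) y) n = coord ((cadjoint T ^^ j) (cadjoint T y)) n"
    by (simp add: funpow_swap1)
  also have "\<dots> = complex_of_real (\<Prod>i<Suc j. mu (n + Suc i)) * coord y (n + Suc j)"
    by (simp add: Suc coord_cadjoint_shift[OF T])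
  finally show ?case .
qed simp

lemma prod_weights_sq: "(\<Prod>i<j. mu (n + Suc i))\<^sup>2 = weight_beta mu (n + j) / weight_beta mu n"
proof (induction j)
  case 0
  show ?case
    using weight_beta_pos[of n mu] pos by simp
next
  case (Suc j)
  then show ?case
    by (simp add: power_mult_distrib weight_beta_Suc)
qed

lemma coord_Bop_shift:
  "coord (Bop m T x) n
    = complex_of_real ((-1) ^ m * fin_diff m (weight_beta mu) n / weight_beta mu n) * coord x n"
proof -
  have diag: "coord ((cadjoint T ^^ j) ((T ^^ j) x)) n
      = complex_of_real (weight_beta mu (n + j) / weight_beta mu n) * coord x n" for j
    by (simp add: coord_cadjoint_shift_power coord_shift_power power2_eq_square
        flip: prod_weights_sq)
  have "coord (Bop m T x) n = (\<Sum>j\<le>m. (-1) ^ j * of_nat (m choose j) *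
      (complex_of_real (weight_beta mu (n + (m - j)) / weight_beta mu n) * coord x n))"
    by (simp add: Bop_def coord_sum diag)
  also have "\<dots> = complex_of_real ((\<Sum>j\<le>m. (-1) ^ j * real (m choose j) * weight_beta mu (n + (m - j)))
      / weight_beta mu n) * coord x n"
    by (simp add: sum_divide_distrib sum_distrib_right mult.assoc)
  finally show ?thesis
    by (simp only: fin_diff_reversed)
qed

text \<open>The entries of \<open>B\<^sub>m(T)\<close> have \<open>\<beta> (n + k)\<close> in the denominator at position \<open>n + k\<close>; it cancels
  against the factor \<open>\<beta> (n + k) / \<beta> n\<close> that comes from \<open>T\<^sup>*\<^sup>k\<close> and \<open>T\<^sup>k\<close> together.\<close>

lemma coord_quasi_defect:
  "coord ((cadjoint T ^^ k) (Bop m T ((T ^^ k) x))) n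
    = complex_of_real ((-1) ^ m * fin_diff m (\<lambda>i. weight_beta mu (k + i)) n / weight_beta mu n)
        * coord x n"
proof -
  have shift: "fin_diff m (weight_beta mu) (n + k) = fin_diff m (\<lambda>i. weight_beta mu (k + i)) n"
    by (simp add: fin_diff_def add_ac)
  have "0 < weight_beta mu (n + k)"
    using weight_beta_pos pos by blast
  have "coord ((cadjoint T ^^ k) (Bop m T ((T ^^ k) x))) n
      = complex_of_real ((\<Prod>i<k. mu (n + Suc i))\<^sup>2
          * ((-1) ^ m * fin_diff m (weight_beta mu) (n + k) / weight_beta mu (n + k))) * coord x n"
    by (simp add: coord_cadjoint_shift_power coord_Bop_shift coord_shift_power power2_eq_square)
  then show ?thesis
    unfolding prod_weights_sq shift using \<open>0 < weight_beta mu (n + k)\<close> by simp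
qed

lemma quasi_isometric_shift_iff:
  "quasi_isometric k m T \<longleftrightarrow> (\<forall>n. fin_diff m (\<lambda>i. weight_beta mu (k + i)) n = 0)"
proof
  assume "quasi_isometric k m T"
  then have "coord ((cadjoint T ^^ k) (Bop m T ((T ^^ k) (ebasis n)))) n = 0" for n
    by (simp add: quasi_isometric_def)
  moreover have "weight_beta mu n \<noteq> 0" for n
    using weight_beta_pos[of n mu] pos by fastforce
  ultimately show "\<forall>n. fin_diff m (\<lambda>i. weight_beta mu (k + i)) n = 0"
    by (simp add: coord_quasi_defect coord_ebasis)
next
  assume "\<forall>n. fin_diff m (\<lambda>i. weight_beta mu (k + i)) n = 0"
  then show "quasi_isometric k m T"
    unfolding quasi_isometric_def by (auto intro!: ell2_eqI simp: coord_quasi_defect)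
qed

lemma strict_quasi_isometric_shift_iff:
  assumes "m \<ge> 1" and w: "\<And>n. weight_beta mu (k + n) = poly w (real n)" and "degree w \<le> m - 1"
  shows "strict_quasi_isometric k m T \<longleftrightarrow> degree w = m - 1"
proof -
  have w0: "w \<noteq> 0"
    using w[of 0] weight_beta_pos[of k mu] pos by fastforce
  have quasi: "quasi_isometric k r T \<longleftrightarrow> (\<forall>i\<ge>r. coeff w i = 0)" for r
  proof -
    have "quasi_isometric k r T
        \<longleftrightarrow> (\<exists>v. (\<forall>i\<ge>r. coeff v i = 0) \<and> (\<forall>n. poly w (real n) = poly v (real n)))"
      by (simp only: quasi_isometric_shift_iff fin_diff_eq_0_iff w)
    also have "\<dots> \<longleftrightarrow> (\<forall>i\<ge>r. coeff w i = 0)"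
      using poly_eq_on_nats by metis
    finally show ?thesis .
  qed
  have "quasi_isometric k m T"
    unfolding quasi using assms by (auto simp: coeff_eq_0)
  moreover have "quasi_isometric k (m - 1) T \<longleftrightarrow> degree w \<noteq> m - 1"
    unfolding quasi
  proof
    assume "\<forall>i\<ge>m - 1. coeff w i = 0"
    then show "degree w \<noteq> m - 1"
      using w0 by (metis leading_coeff_0_iff order_refl)
  qed (use assms(3) in \<open>auto simp: coeff_eq_0\<close>)
  ultimately show ?thesis
    by (simp add: strict_quasi_isometric_def)
qed

end

section \<open>Completions with prescribed moments\<close>

lemma completion_of_moments:
  assumes b0: "b 0 = 1" and b_pos: "\<And>s. 0 < b s"
    and b_w: "\<And>n. b (k + n) = poly w (real n)"
    and b_lam: "\<And>s. s \<le> l \<Longrightarrow> b s = weight_beta lam s"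
    and lam: "\<forall>n\<in>{1..l}. 0 < lam n"
  shows "\<exists>mu T. extends_weights lam l mu \<and> (\<forall>s. weight_beta mu s = b s)
    \<and> is_bounded_weighted_shift mu T"
proof -
  define mu where "mu n = sqrt (b n / b (n - 1))" for n
  have mu_pos: "0 < mu n" for n
    using b_pos by (simp add: mu_def)
  have beta: "weight_beta mu s = b s" for s
  proof (induction s)
    case (Suc s)
    have "(mu (Suc s))\<^sup>2 = b (Suc s) / b s"
      using b_pos[of s] b_pos[of "Suc s"] by (simp add: mu_def less_imp_le)
    then show ?case
      using Suc b_pos[of s] by (simp add: weight_beta_Suc)
  qed (simp add: b0 weight_beta_0)
  have "mu n = lam n" if n: "n \<in> {1..l}" for n
  proof -
    obtain n' where n': "n = Suc n'"
      using n by (cases n) auto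
    have "b n = b n' * (lam n)\<^sup>2"
      using n b_lam[of n] b_lam[of n'] by (simp add: n' weight_beta_Suc)
    then have "mu n = sqrt ((lam n)\<^sup>2)"
      using b_pos[of n'] by (simp add: mu_def n')
    then show ?thesis
      using lam n by (simp add: less_imp_le)
  qed
  then have ext: "extends_weights lam l mu"
    using mu_pos by (simp add: extends_weights_def)
  have "poly w (real n) > 0" for n
    using b_pos b_w by metis
  then obtain K where K: "\<And>n. poly w (real (Suc n)) / poly w (real n) \<le> K"
    using poly_successive_quotients_bounded by blast
  \<comment> \<open>The weights up to \<open>mu k\<close> are not quotients of values of \<open>w\<close>, but they are finitely many.\<close>
  have "\<bar>mu n\<bar> \<le> (\<Sum>i\<le>k. \<bar>mu i\<bar>) + sqrt K" for n
  proof (cases "n \<le> k")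
    case True
    have "0 \<le> K"
      using K[of 0] b_pos[of "k + 0"] b_pos[of "k + Suc 0"] unfolding b_w
      by (meson divide_pos_pos less_imp_le less_le_trans)
    then show ?thesis
      using member_le_sum[of n "{..k}" "\<lambda>i. \<bar>mu i\<bar>"] True by (simp add: add_increasing2)
  next
    case False
    then obtain i where i: "n = Suc (k + i)"
      using less_iff_Suc_add[of k n] by auto
    have "\<bar>mu n\<bar> \<le> sqrt K"
      using K[of i] mu_pos[of n] b_w[of i] b_w[of "Suc i"] by (simp add: mu_def i)
    then show ?thesis
      by (simp add: add_increasing sum_nonneg)
  qed
  then obtain T where "is_bounded_weighted_shift mu T"
    using bounded_weighted_shift_exists by blast
  then show ?thesis
    using ext beta by blast
qed

text \<open>For \<open>m = 1\<close> the polynomial is an arbitrary positive constant, and the first weight that is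
  not prescribed is \<open>\<lambda>\<^sub>k\<close>. For this reason the moments are taken from \<open>lam\<close> below \<open>k\<close> and from \<open>w\<close>
  at \<open>k\<close> already.\<close>

lemma strict_completion_exists:
  assumes m: "m \<ge> 1" and k: "k \<ge> 1" and lam: "\<forall>n\<in>{1..k+m-2}. 0 < lam n"
  shows "\<exists>mu. strict_quasi_completion k m lam (k + m - 2) mu"
proof -
  have lam_beta: "0 < weight_beta lam s" if "s \<le> k + m - 2" for s
    using that lam by (intro weight_beta_pos) auto
  obtain w where w: "degree w = m - 1" "\<forall>n<m-1. poly w (real n) = weight_beta lam (k + n)"
    "\<And>n. poly w (real n) > 0"
    using positive_interpolation[of "m - 1" "\<lambda>n. weight_beta lam (k + n)"] lam_beta by auto
  define b where "b s = (if s < k then weight_beta lam s else poly w (real (s - k)))" for s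
  have b_w: "b (k + n) = poly w (real n)" for n
    by (simp add: b_def)
  have "\<exists>mu T. extends_weights lam (k + m - 2) mu \<and> (\<forall>s. weight_beta mu s = b s)
      \<and> is_bounded_weighted_shift mu T"
  proof (rule completion_of_moments)
    show "b 0 = 1"
      using k by (simp add: b_def weight_beta_0)
    show "0 < b s" for s
      using lam_beta w(3) m by (simp add: b_def del: of_nat_diff)
    show "b (k + n) = poly w (real n)" for n
      by (rule b_w)
    show "b s = weight_beta lam s" if "s \<le> k + m - 2" for s
    proof (cases "s < k")
      case False
      then have "s - k < m - 1"
        using that m k by linarith
      then show ?thesis
        using False w(2) by (simp add: b_def del: of_nat_diff)
    qed (simp add: b_def)
  qed (rule lam)
  then obtain mu T where mu: "extends_weights lam (k + m - 2) mu" "\<And>s. weight_beta mu s = b s"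
    and T: "is_bounded_weighted_shift mu T"
    by blast
  have "strict_quasi_isometric k m T"
    using strict_quasi_isometric_shift_iff[OF T _ m, of k w] mu w(1)
    by (simp add: extends_weights_def b_w)
  then show ?thesis
    using mu T by (auto simp: strict_quasi_completion_def)
qed

lemma interp_poly_props:
  assumes "m \<ge> 1"
  shows "degree (interp_poly k m lam) \<le> m - 1"
    and "n < m \<Longrightarrow> poly (interp_poly k m lam) (real n) = weight_beta lam (k + n)"
  using theI'[OF interp_poly_ex1[OF assms, of lam k]] unfolding interp_poly_def by auto

text \<open>If \<open>l > k + m - 2\<close>, the prescribed weights determine the moments \<open>\<beta> k, \<dots>, \<beta> (k + m - 1)\<close>, and
  hence those of every completion from \<open>k\<close> on.\<close>

lemma quasi_completion_moments:
  assumes m: "m \<ge> 1" and l: "l > k + m - 2" and mu: "quasi_completion k m lam l mu"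
  shows "weight_beta mu (k + n) = poly (interp_poly k m lam) (real n)"
proof -
  let ?w = "interp_poly k m lam"
  obtain T where ext: "extends_weights lam l mu" and T: "is_bounded_weighted_shift mu T"
    "quasi_isometric k m T"
    using mu by (auto simp: quasi_completion_def)
  have coeff_w: "\<forall>i\<ge>m. coeff ?w i = 0"
    using interp_poly_props(1)[OF m, of k lam] m by (auto intro!: coeff_eq_0)
  have init: "weight_beta mu (k + i) = weight_beta lam (k + i)" if "i < m" for i
    using that ext l by (intro weight_beta_cong) (auto simp: extends_weights_def)
  have "\<forall>n. fin_diff m (\<lambda>i. weight_beta mu (k + i)) n = 0"
    using quasi_isometric_shift_iff[OF T(1)] T(2) ext by (simp add: extends_weights_def)
  then have "weight_beta mu (k + n) - poly ?w (real n) = 0"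
    using fin_diff_determines[of m n "\<lambda>i. weight_beta mu (k + i) - poly ?w (real i)" n]
    by (simp add: fin_diff_minus fin_diff_poly_eq_0[OF coeff_w] init interp_poly_props(2)[OF m])
  then show ?thesis
    by simp
qed

lemma quasi_completion_exists:
  assumes m: "m \<ge> 1" and k: "k \<ge> 1" and l: "l > k + m - 2" and lam: "\<forall>n\<in>{1..l}. 0 < lam n"
    and diff: "\<And>n. n + (k + m) \<le> l \<Longrightarrow> fin_diff m (\<lambda>i. weight_beta lam (k + i)) n = 0"
    and pos: "\<And>n. n \<ge> m \<Longrightarrow> poly (interp_poly k m lam) (real n) > 0"
  shows "\<exists>mu. quasi_completion k m lam l mu"
proof -
  define w where "w = interp_poly k m lam"
  have coeff_w: "\<forall>i\<ge>m. coeff w i = 0"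
    using interp_poly_props(1)[OF m, of k lam] m by (auto intro!: coeff_eq_0 simp: w_def)
  have lam_beta: "0 < weight_beta lam s" if "s \<le> l" for s
    using that lam by (intro weight_beta_pos) auto
  have w_beta: "weight_beta lam (k + n) = poly w (real n)" if "k + n \<le> l" for n
  proof -
    have "weight_beta lam (k + n) - poly w (real n) = 0"
    proof (rule fin_diff_determines[of m "l - k" "\<lambda>i. weight_beta lam (k + i) - poly w (real i)"])
      show "fin_diff m (\<lambda>i. weight_beta lam (k + i) - poly w (real i)) i = 0"
        if "i + m \<le> l - k" for i
        using that diff[of i] m by (simp add: fin_diff_minus fin_diff_poly_eq_0[OF coeff_w])
      show "weight_beta lam (k + i) - poly w (real i) = 0" if "i < m" for i
        using that interp_poly_props(2)[OF m] by (simp add: w_def)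
    qed (use that in simp)
    then show ?thesis
      by simp
  qed
  have w_pos: "poly w (real n) > 0" for n
  proof (cases "n < m")
    case True
    then show ?thesis
      using interp_poly_props(2)[OF m True, of k lam] lam_beta[of "k + n"] l by (simp add: w_def)
  qed (use pos in \<open>simp add: w_def\<close>)
  define b where "b s = (if s < k then weight_beta lam s else poly w (real (s - k)))" for s
  have b_w: "b (k + n) = poly w (real n)" for n
    by (simp add: b_def)
  have "\<exists>mu T. extends_weights lam l mu \<and> (\<forall>s. weight_beta mu s = b s)
      \<and> is_bounded_weighted_shift mu T"
  proof (rule completion_of_moments)
    show "b 0 = 1"
      using k by (simp add: b_def weight_beta_0)
    show "0 < b s" for s
      using lam_beta[of s] w_pos m l by (simp add: b_def del: of_nat_diff)
    show "b (k + n) = poly w (real n)" for n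
      by (rule b_w)
    show "b s = weight_beta lam s" if "s \<le> l" for s
      using that w_beta[of "s - k"] by (auto simp: b_def simp del: of_nat_diff)
  qed (rule lam)
  then obtain mu T where mu: "extends_weights lam l mu" "\<And>s. weight_beta mu s = b s"
    and T: "is_bounded_weighted_shift mu T"
    by blast
  have "quasi_isometric k m T"
    using quasi_isometric_shift_iff[OF T, of k m] mu fin_diff_poly_eq_0[OF coeff_w]
    by (simp add: extends_weights_def b_w)
  then show ?thesis
    using mu T by (auto simp: quasi_completion_def)
qed

theorem proposition2p2:
  fixes m l k :: nat and lam :: "nat \<Rightarrow> real"
  assumes "m \<ge> 1" and "l \<ge> 1" and "k \<ge> 1"
    and "\<forall>n\<in>{1..l}. lam n > 0"
  shows
    "(l \<le> k + m - 2 \<longrightarrow>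
        (\<forall>kap :: nat \<Rightarrow> real. (\<forall>n\<in>{l+1..k+m-2}. kap n > 0) \<longrightarrow>
           (\<exists>mu. strict_quasi_completion k m lam l mu \<and> (\<forall>n\<in>{l+1..k+m-2}. mu n = kap n))))
     \<and>
     (l > k + m - 2 \<longrightarrow>
        ((\<exists>mu. quasi_completion k m lam l mu) \<longleftrightarrow>
           (\<forall>n. n + (k + m) \<le> l \<longrightarrow>
              (\<Sum>j\<le>m. (-1) ^ j * real (m choose j) * weight_beta lam (k + n + j)) = 0) \<and>
           (\<forall>n\<ge>m. poly (interp_poly k m lam) (real n) > 0)) \<and>
        (\<forall>mu. quasi_completion k m lam l mu \<longrightarrow>
           (strict_quasi_completion k m lam l mu \<longleftrightarrow> degree (interp_poly k m lam) = m - 1)))"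
proof (intro conjI impI allI)
  note m = assms(1) and k = assms(3) and lam = assms(4)
  {
    fix kap :: "nat \<Rightarrow> real"
    assume l: "l \<le> k + m - 2" and kap: "\<forall>n\<in>{l+1..k+m-2}. kap n > 0"
    define nu where "nu n = (if n \<le> l then lam n else kap n)" for n
    have "\<forall>n\<in>{1..k+m-2}. 0 < nu n"
      using lam kap by (auto simp: nu_def)
    then obtain mu where "strict_quasi_completion k m nu (k + m - 2) mu"
      using strict_completion_exists[OF m k] by blast
    moreover from this have "mu n = nu n" if "n \<in> {1..k+m-2}" for n
      using that by (simp add: strict_quasi_completion_def extends_weights_def)
    ultimately show "\<exists>mu. strict_quasi_completion k m lam l mu \<and> (\<forall>n\<in>{l+1..k+m-2}. mu n = kap n)"
      using l by (intro exI[of _ mu])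
        (auto simp: strict_quasi_completion_def extends_weights_def nu_def)
  next
    assume l: "l > k + m - 2"
    let ?w = "interp_poly k m lam"
    have fin_diff: "(\<Sum>j\<le>m. (-1) ^ j * real (m choose j) * weight_beta lam (k + n + j))
        = fin_diff m (\<lambda>i. weight_beta lam (k + i)) n" for n
      by (simp add: fin_diff_def add.assoc)
    show "(\<exists>mu. quasi_completion k m lam l mu) \<longleftrightarrow>
           (\<forall>n. n + (k + m) \<le> l \<longrightarrow>
              (\<Sum>j\<le>m. (-1) ^ j * real (m choose j) * weight_beta lam (k + n + j)) = 0) \<and>
           (\<forall>n\<ge>m. poly ?w (real n) > 0)"
    proof
      assume "\<exists>mu. quasi_completion k m lam l mu"
      then obtain mu where mu: "quasi_completion k m lam l mu"
        by blast
      then have ext: "extends_weights lam l mu"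
        by (simp add: quasi_completion_def)
      obtain T where T: "is_bounded_weighted_shift mu T" "quasi_isometric k m T"
        using mu by (auto simp: quasi_completion_def)
      have diff: "fin_diff m (\<lambda>i. weight_beta mu (k + i)) n = 0" for n
        using quasi_isometric_shift_iff[OF T(1)] T(2) ext by (simp add: extends_weights_def)
      have "fin_diff m (\<lambda>i. weight_beta lam (k + i)) n = 0" if "n + (k + m) \<le> l" for n
      proof -
        have "weight_beta lam (k + (n + j)) = weight_beta mu (k + (n + j))" if "j \<le> m" for j
          using that \<open>n + (k + m) \<le> l\<close> ext
          by (intro weight_beta_cong) (auto simp: extends_weights_def)
        then have "fin_diff m (\<lambda>i. weight_beta lam (k + i)) n
            = fin_diff m (\<lambda>i. weight_beta mu (k + i)) n"
          unfolding fin_diff_def by (intro sum.cong) auto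
        then show ?thesis
          using diff by simp
      qed
      moreover have "poly ?w (real n) > 0" for n
        using quasi_completion_moments[OF m l mu, of n] weight_beta_pos[of "k + n" mu] ext
        by (simp add: extends_weights_def)
      ultimately show "(\<forall>n. n + (k + m) \<le> l \<longrightarrow>
              (\<Sum>j\<le>m. (-1) ^ j * real (m choose j) * weight_beta lam (k + n + j)) = 0) \<and>
           (\<forall>n\<ge>m. poly ?w (real n) > 0)"
        by (simp add: fin_diff)
    next
      assume "(\<forall>n. n + (k + m) \<le> l \<longrightarrow>
              (\<Sum>j\<le>m. (-1) ^ j * real (m choose j) * weight_beta lam (k + n + j)) = 0) \<and>
           (\<forall>n\<ge>m. poly ?w (real n) > 0)"
      then show "\<exists>mu. quasi_completion k m lam l mu"
        using quasi_completion_exists[OF m k l lam] by (simp add: fin_diff)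
    qed
    fix mu
    assume mu: "quasi_completion k m lam l mu"
    then have ext: "extends_weights lam l mu"
      by (simp add: quasi_completion_def)
    have "strict_quasi_isometric k m T \<longleftrightarrow> degree ?w = m - 1"
      if "is_bounded_weighted_shift mu T" for T
      using strict_quasi_isometric_shift_iff[OF that _ m quasi_completion_moments[OF m l mu]
          interp_poly_props(1)[OF m]] ext
      by (simp add: extends_weights_def)
    then show "strict_quasi_completion k m lam l mu \<longleftrightarrow> degree ?w = m - 1"
      using mu by (auto simp: strict_quasi_completion_def quasi_completion_def)
  }
qed

end
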